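(* Let structure maps $(A,B,C,D)$ be represented by a process $(\mathcal H,V,\mathfrak h)$ with represented input space $\mathcal U_0\subset\mathcal E$ and represented output space $\mathcal Y_0\subset\mathfrak h\oplus\mathcal E$. Let $\tilde\xi=\xi\oplus\bigoplus_{\alpha\in F_d^+}V_\alpha\eta_\alpha\in\mathcal H$ with $\xi\in\mathfrak h$ and $\eta_\alpha\in\mathcal U_0$, and let $p=P_{\mathfrak h}$. For all words $\alpha\in F_d^+$ put $$x(0):=\xi,\qquad x(\alpha):=p\,V_\alpha^*\tilde\xi,\qquad u(\alpha):=\eta_\alpha$$ (it follows that $V_\alpha x(\alpha)=P_{V_\alpha\mathfrak h}\tilde\xi$ and $V_\alpha u(\alpha)=P_{V_\alpha\mathcal U_0}\tilde\xi$). Then for all words $\alpha$ and all generators $k=1,\dots,d$ $$x(\alpha k)=A_k\,x(\alpha)+B_k\,u(\alpha).$$ If further $y(\alpha):=P_{\mathcal Y_0}V_\alpha^*\tilde\xi$ (so that $V_\alpha y(\alpha)=P_{V_\alpha\mathcal Y_0}\tilde\xi$), then for all words $\alpha$ $$y(\alpha)=C\,x(\alpha)+D\,u(\alpha).$$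
   Context: Let $\mathcal P$ be a separable Hilbert space with orthonormal basis $(\epsilon_k)_{k=1}^d$ ($d\in\mathbb N$ or $d=\infty$), and let $F_d^+$ be the free semigroup of words in the letters $1,\dots,d$, including the empty word $0$; $\alpha k$ is the concatenation of $\alpha$ and the letter $k$. A row isometry on a separable Hilbert space $\mathcal H$ is an isometry $V:\mathcal H\otimes\mathcal P\to\mathcal H$; put $V_k\xi=V(\xi\otimes\epsilon_k)$, $V_\alpha=V_{\alpha_1}\cdots V_{\alpha_n}$ for $\alpha=\alpha_1\dots\alpha_n$, $V_0=1$, and $V_\alpha^*=(V_\alpha)^*$. A closed subspace $\mathfrak h$ is co-invariant if $V_k^*\mathfrak h\subset\mathfrak h$ for all $k$. A process (= minimal discrete weak Markov process) is a triple $(\mathcal H,V,\mathfrak h)$ where $V$ is a row isometry on $\mathcal H$, $\mathfrak h\subset\mathcal H$ is a co-invariant closed subspace, and $\mathcal H=\overline{\mathrm{span}}\{V_\alpha\mathfrak h:\alpha\in F_d^+\}$. Put $\mathcal E=\overline{\mathrm{span}}(\mathfrak h,V(\mathfrak h\otimes\mathcal P))\ominus\mathfrak h$; then $V_\alpha\mathcal E\perp V_\beta\mathcal E$ for $\alpha\ne\beta$ and $\mathcal H=\mathfrak h\oplus\bigoplus_\alpha V_\alpha\mathcal E$. $P_{\mathcal L}$ is the orthogonal projection onto a closed subspace $\mathcal L$. A representation of structure maps $(A,B,C,D)$ by $(\mathcal H,V,\mathfrak h)$ with (closed) represented input space $\mathcal U_0\subset\mathcal E$ and represented output space $\mathcal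 Y_0\subset\mathfrak h\oplus\mathcal E$ means (identifying the abstract input and output spaces $\mathcal U,\mathcal Y$ with $\mathcal U_0,\mathcal Y_0$ via isometries which are suppressed): $A=(A_1,\dots,A_d)^t=V^*|_{\mathfrak h}$, i.e. $A_k=V_k^*|_{\mathfrak h}:\mathfrak h\to\mathfrak h$; $B=(B_1,\dots,B_d)^t=V^*|_{\mathcal U_0}$, i.e. $B_k=V_k^*|_{\mathcal U_0}:\mathcal U_0\to\mathfrak h$; $C=P_{\mathcal Y_0}|_{\mathfrak h}:\mathfrak h\to\mathcal Y_0$; $D=P_{\mathcal Y_0}|_{\mathcal U_0}:\mathcal U_0\to\mathcal Y_0$. *)

theory Defs
  imports "HOL-Analysis.Analysis"
begin

section \<open>Complex Hilbert spaces\<close>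

text \<open>The inner product is antilinear in its first and linear in its second argument. The
  inherited real scalar multiplication and norm are tied to the complex structure.\<close>

class chilbert_space = banach +
  fixes scaleC :: "complex \<Rightarrow> 'a \<Rightarrow> 'a"  (infixr \<open>*\<^sub>C\<close> 75)
    and cinner :: "'a \<Rightarrow> 'a \<Rightarrow> complex"
  assumes scaleC_add_right: "c *\<^sub>C (x + y) = c *\<^sub>C x + c *\<^sub>C y"
    and scaleC_add_left: "(b + c) *\<^sub>C x = b *\<^sub>C x + c *\<^sub>C x"
    and scaleC_scaleC: "b *\<^sub>C c *\<^sub>C x = (b * c) *\<^sub>C x"
    and scaleC_one: "1 *\<^sub>C x = x"
    and scaleR_scaleC: "r *\<^sub>R x = complex_of_real r *\<^sub>C x"
    and cinner_commute: "cinner x y = cnj (cinner y x)"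
    and cinner_add_right: "cinner x (y + z) = cinner x y + cinner x z"
    and cinner_scaleC_right: "cinner x (c *\<^sub>C y) = c * cinner x y"
    and cinner_self: "cinner x x = complex_of_real ((norm x)\<^sup>2)"

global_interpretation complex_vector: vector_space "scaleC :: complex \<Rightarrow> 'a \<Rightarrow> 'a::chilbert_space"
  defines csubspace = complex_vector.subspace
    and cspan = complex_vector.span
  by unfold_locales (rule scaleC_add_right scaleC_add_left scaleC_scaleC scaleC_one)+

abbreviation clinear :: "('a::chilbert_space \<Rightarrow> 'b::chilbert_space) \<Rightarrow> bool"
  where "clinear \<equiv> Vector_Spaces.linear (*\<^sub>C) (*\<^sub>C)"

definition closed_csubspace :: "'a::chilbert_space set \<Rightarrow> bool"
  where "closed_csubspace L \<longleftrightarrow> csubspace L \<and> closed L"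

definition closed_cspan :: "'a::chilbert_space set \<Rightarrow> 'a set"
  where "closed_cspan S = closure (cspan S)"

text \<open>Orthogonal projection onto \<open>L\<close>; determined when \<open>L\<close> is a closed subspace.\<close>

definition cproj :: "'a::chilbert_space set \<Rightarrow> 'a \<Rightarrow> 'a"
  where "cproj L v = (THE w. w \<in> L \<and> (\<forall>z\<in>L. cinner z (v - w) = 0))"

text \<open>Hilbert space adjoint; determined when \<open>f\<close> is a bounded linear operator.\<close>

definition cadjoint :: "('a::chilbert_space \<Rightarrow> 'b::chilbert_space) \<Rightarrow> 'b \<Rightarrow> 'a"
  where "cadjoint f = (THE g. \<forall>v w. cinner (f v) w = cinner v (g w))"

definition cisometry :: "('a::chilbert_space \<Rightarrow> 'b::chilbert_space) \<Rightarrow> bool"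
  where "cisometry f \<longleftrightarrow> clinear f \<and> (\<forall>v. norm (f v) = norm v)"

text \<open>The elementary tensors \<open>T x a\<close> present the type \<open>'hp\<close> as the Hilbert space tensor product of
  \<open>'h\<close> and \<open>'p\<close>. These properties determine \<open>('hp, T)\<close> up to a unique unitary.\<close>

definition hilbert_tensor ::
    "('h::chilbert_space \<Rightarrow> 'p::chilbert_space \<Rightarrow> 'hp::chilbert_space) \<Rightarrow> bool"
  where "hilbert_tensor T \<longleftrightarrow>
    (\<forall>a. clinear (\<lambda>x. T x a)) \<and>
    (\<forall>x. clinear (T x)) \<and>
    (\<forall>x a y b. cinner (T x a) (T y b) = cinner x y * cinner a b) \<and>
    closed_cspan {T x a | x a. True} = UNIV"


section \<open>Words and row isometries\<close>

text \<open>\<open>d = \<infinity>\<close> is the case of infinitely many letters. The empty word is \<open>[]\<close>.\<close>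

definition letters :: "enat \<Rightarrow> nat set"
  where "letters d = {k. 1 \<le> k \<and> enat k \<le> d}"

definition free_words :: "enat \<Rightarrow> nat list set"
  where "free_words d = lists (letters d)"

definition orthonormal_basis :: "enat \<Rightarrow> (nat \<Rightarrow> 'p::chilbert_space) \<Rightarrow> bool"
  where "orthonormal_basis d e \<longleftrightarrow>
    (\<forall>j\<in>letters d. \<forall>k\<in>letters d. cinner (e j) (e k) = (if j = k then 1 else 0)) \<and>
    closed_cspan (e ` letters d) = UNIV"

definition row_op ::
    "('h \<Rightarrow> 'p \<Rightarrow> 'hp) \<Rightarrow> (nat \<Rightarrow> 'p) \<Rightarrow> ('hp \<Rightarrow> 'h) \<Rightarrow> nat \<Rightarrow> 'h \<Rightarrow> 'h"
  where "row_op T e V k v = V (T v (e k))"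

primrec word_op ::
    "('h \<Rightarrow> 'p \<Rightarrow> 'hp) \<Rightarrow> (nat \<Rightarrow> 'p) \<Rightarrow> ('hp \<Rightarrow> 'h) \<Rightarrow> nat list \<Rightarrow> 'h \<Rightarrow> 'h"
  where
    "word_op T e V [] = id"
  | "word_op T e V (k # \<alpha>) = row_op T e V k \<circ> word_op T e V \<alpha>"


section \<open>Processes and represented structure maps\<close>

definition markov_process ::
    "('h::chilbert_space \<Rightarrow> 'p::chilbert_space \<Rightarrow> 'hp::chilbert_space) \<Rightarrow> enat \<Rightarrow> (nat \<Rightarrow> 'p) \<Rightarrow>
      ('hp \<Rightarrow> 'h) \<Rightarrow> 'h set \<Rightarrow> bool"
  where "markov_process T d e V h \<longleftrightarrow>
    cisometry V \<and>
    closed_csubspace h \<and>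
    (\<forall>k\<in>letters d. cadjoint (row_op T e V k) ` h \<subseteq> h) \<and>
    closed_cspan (\<Union>\<alpha>\<in>free_words d. word_op T e V \<alpha> ` h) = UNIV"

text \<open>The space \<open>\<E>\<close>. The closed span of the elementary tensors over \<open>h\<close> is \<open>h \<otimes> \<P>\<close>, regarded as a
  subspace of \<open>\<H> \<otimes> \<P>\<close>.\<close>

definition innovation_space ::
    "('h::chilbert_space \<Rightarrow> 'p::chilbert_space \<Rightarrow> 'hp::chilbert_space) \<Rightarrow> ('hp \<Rightarrow> 'h) \<Rightarrow>
      'h set \<Rightarrow> 'h set"
  where "innovation_space T V h =
    {v \<in> closed_cspan (h \<union> V ` closed_cspan {T x a | x a. x \<in> h}). \<forall>z\<in>h. cinner z v = 0}"

text \<open>The structure maps are only constrained on their domains \<open>h\<close> (for \<open>A\<close>, \<open>C\<close>) and \<open>U0\<close> (for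
  \<open>B\<close>, \<open>D\<close>). The abstract input and output spaces are identified with \<open>U0\<close> and \<open>Y0\<close>.\<close>

definition represents ::
    "('h::chilbert_space \<Rightarrow> 'p::chilbert_space \<Rightarrow> 'hp::chilbert_space) \<Rightarrow> enat \<Rightarrow> (nat \<Rightarrow> 'p) \<Rightarrow>
      ('hp \<Rightarrow> 'h) \<Rightarrow> 'h set \<Rightarrow> 'h set \<Rightarrow> 'h set \<Rightarrow>
      (nat \<Rightarrow> 'h \<Rightarrow> 'h) \<Rightarrow> (nat \<Rightarrow> 'h \<Rightarrow> 'h) \<Rightarrow> ('h \<Rightarrow> 'h) \<Rightarrow> ('h \<Rightarrow> 'h) \<Rightarrow> bool"
  where "represents T d e V h U0 Y0 A B C D \<longleftrightarrow>
    closed_csubspace U0 \<and> U0 \<subseteq> innovation_space T V h \<and>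
    closed_csubspace Y0 \<and> Y0 \<subseteq> {v + w | v w. v \<in> h \<and> w \<in> innovation_space T V h} \<and>
    (\<forall>k\<in>letters d. \<forall>v\<in>h. A k v = cadjoint (row_op T e V k) v) \<and>
    (\<forall>k\<in>letters d. \<forall>w\<in>U0. B k w = cadjoint (row_op T e V k) w) \<and>
    (\<forall>v\<in>h. C v = cproj Y0 v) \<and>
    (\<forall>w\<in>U0. D w = cproj Y0 w)"

end

theory Submission
  imports Defs
begin

text \<open>Every \<open>V\<^sub>\<alpha> \<E>\<close> is orthogonal to \<open>h\<close>, and the spaces \<open>V\<^sub>\<alpha> \<E>\<close> are pairwise orthogonal, because
  \<open>V\<^sub>k f\<close> is orthogonal to \<open>h + V (h \<otimes> \<P>)\<close> whenever \<open>f\<close> is orthogonal to \<open>h\<close>. Pairing the series with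
  \<open>V\<^sub>\<alpha> z\<close> therefore shows that \<open>V\<^sub>\<alpha>\<^sup>* \<xi>t = x \<alpha> + u \<alpha> + r\<close> with \<open>r\<close> orthogonal to \<open>h \<oplus> \<E>\<close>.
  The residual \<open>r\<close> is invisible to the output, since \<open>Y0 \<subseteq> h \<oplus> \<E>\<close>, and to the next state, since
  \<open>V\<^sub>k h \<subseteq> h \<oplus> \<E>\<close>.\<close>

section \<open>Inner product identities and the Cauchy-Schwarz inequality\<close>

lemma cinner_add_left: "cinner (x + y) z = cinner x z + cinner y z"
  by (metis cinner_add_right cinner_commute complex_cnj_add)

lemma cinner_scaleC_left: "cinner (c *\<^sub>C x) y = cnj c * cinner x y"
  by (metis cinner_commute cinner_scaleC_right complex_cnj_mult)

lemma cinner_zero_right [simp]: "cinner x 0 = 0"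
  using cinner_add_right[of x 0 0] by simp

lemma cinner_zero_left [simp]: "cinner 0 x = 0"
  using cinner_add_left[of 0 0 x] by simp

lemma cinner_diff_right: "cinner x (y - z) = cinner x y - cinner x z"
  using cinner_add_right[of x "y - z" z] by simp

lemma cinner_diff_left: "cinner (x - y) z = cinner x z - cinner y z"
  using cinner_add_left[of "x - y" y z] by simp

lemma cinner_orthogonal_commute: "cinner x y = 0 \<longleftrightarrow> cinner y x = 0"
  by (metis cinner_commute complex_cnj_zero)

lemma cinner_eq_zero_iff [simp]: "cinner x x = 0 \<longleftrightarrow> x = 0"
  by (simp add: cinner_self)

lemma Re_cinner_commute: "Re (cinner x y) = Re (cinner y x)"
  by (subst cinner_commute) simp

lemma norm_add_sq:
  "(norm (x + y))\<^sup>2 = (norm x)\<^sup>2 + 2 * Re (cinner x y) + (norm (y :: 'a::chilbert_space))\<^sup>2"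
proof -
  have "complex_of_real ((norm (x + y))\<^sup>2) = cinner x x + cinner x y + cinner y x + cinner y y"
    unfolding cinner_self[symmetric] by (simp add: cinner_add_left cinner_add_right)
  from arg_cong[OF this, of Re] show ?thesis
    using Re_cinner_commute[of x y] by (simp add: cinner_self)
qed

lemma norm_diff_sq:
  "(norm (x - y))\<^sup>2 = (norm x)\<^sup>2 - 2 * Re (cinner x y) + (norm (y :: 'a::chilbert_space))\<^sup>2"
  using norm_add_sq[of "x - y" y] by (simp add: cinner_diff_left cinner_self)

lemma parallelogram_law:
  "(norm (x + y))\<^sup>2 + (norm (x - y))\<^sup>2 = 2 * (norm x)\<^sup>2 + 2 * (norm (y :: 'a::chilbert_space))\<^sup>2"
  by (simp add: norm_add_sq norm_diff_sq)

lemma norm_scaleC: "norm (c *\<^sub>C x) = cmod c * norm x"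
proof -
  have "cinner (c *\<^sub>C x) (c *\<^sub>C x) = (c * cnj c) * cinner x x"
    by (simp add: cinner_scaleC_left cinner_scaleC_right)
  then have "complex_of_real ((norm (c *\<^sub>C x))\<^sup>2) = complex_of_real ((cmod c)\<^sup>2 * (norm x)\<^sup>2)"
    unfolding cinner_self complex_norm_square[symmetric] by (simp only: of_real_mult)
  then have "(norm (c *\<^sub>C x))\<^sup>2 = (cmod c * norm x)\<^sup>2"
    unfolding of_real_eq_iff power_mult_distrib .
  then show ?thesis by (simp add: power2_eq_iff_nonneg)
qed

text \<open>Pythagoras: the vector subtracted is the component of \<open>v\<close> along
  \<open>z\<close>. Nonnegativity of the left side yields Cauchy-Schwarz; the drop on the right
  drives the nearest-point argument for projections.\<close>

lemma norm_diff_component_sq: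
  fixes z v :: "'a::chilbert_space"
  assumes "z \<noteq> 0"
  shows "(norm (v - (cinner z v / (norm z)\<^sup>2) *\<^sub>C z))\<^sup>2
    = (norm v)\<^sup>2 - (cmod (cinner z v))\<^sup>2 / (norm z)\<^sup>2"
proof -
  define c where "c = cinner z v / (norm z)\<^sup>2"
  have "cinner v (c *\<^sub>C z) = complex_of_real ((cmod (cinner z v))\<^sup>2 / (norm z)\<^sup>2)"
    by (simp add: c_def cinner_scaleC_right cinner_commute[of v z] complex_norm_square
        del: of_real_power)
  moreover have "(norm (c *\<^sub>C z))\<^sup>2 = (cmod (cinner z v))\<^sup>2 / (norm z)\<^sup>2"
    using assms
    by (simp add: c_def norm_scaleC norm_divide norm_mult power2_eq_square)
  ultimately show ?thesis
    unfolding c_def[symmetric] norm_diff_sq by simp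
qed

lemma cinner_Cauchy_Schwarz: "cmod (cinner x y) \<le> norm x * norm y"
proof (cases "x = 0")
  case False
  have "0 \<le> (norm y)\<^sup>2 - (cmod (cinner x y))\<^sup>2 / (norm x)\<^sup>2"
    unfolding norm_diff_component_sq[OF False, symmetric] by simp
  then have "(cmod (cinner x y))\<^sup>2 \<le> (norm x * norm y)\<^sup>2"
    using False by (simp add: field_simps)
  then show ?thesis by (rule power2_le_imp_le) simp
qed simp

lemma bounded_linear_cinner: "bounded_linear (cinner x)"
  by (rule bounded_linear_intro[of _ "norm x"])
    (simp_all add: cinner_add_right scaleR_scaleC cinner_scaleC_right scaleR_conv_of_real
      mult.commute[of _ "norm x"] cinner_Cauchy_Schwarz)

section \<open>Closed linear spans\<close>

lemma orthogonal_closed_cspan: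
  assumes "\<And>s. s \<in> S \<Longrightarrow> cinner w s = 0" and "v \<in> closed_cspan S"
  shows "cinner w v = 0"
proof -
  have "csubspace {s. cinner w s = 0}"
    by (rule complex_vector.subspaceI) (auto simp: cinner_add_right cinner_scaleC_right)
  then have "cspan S \<subseteq> {s. cinner w s = 0}"
    using assms(1) by (intro complex_vector.span_minimal) auto
  moreover have "closed {s. cinner w s = 0}"
    using linear_continuous_on[OF bounded_linear_cinner[of w]]
    by (intro closed_Collect_eq) auto
  ultimately show ?thesis
    using assms(2) closure_minimal unfolding closed_cspan_def by blast
qed

lemma closed_cspan_superset: "S \<subseteq> closed_cspan S"
  unfolding closed_cspan_def using closure_subset complex_vector.span_superset by blast

text \<open>Translation by \<open>- w\<close> is continuous and maps the span into itself, hence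
  maps its closure into itself.\<close>

lemma closed_cspan_diff:
  assumes "v \<in> closed_cspan S" and "w \<in> S"
  shows "v - w \<in> closed_cspan S"
proof -
  have "(\<lambda>s. s - w) ` closure (cspan S) \<subseteq> closure (cspan S)"
    using assms(2)
    by (intro image_closure_subset)
      (auto intro!: continuous_intros intro: closure_subset[THEN subsetD] complex_vector.span_diff
        complex_vector.span_base)
  then show ?thesis using assms(1) unfolding closed_cspan_def by blast
qed

section \<open>The projection theorem\<close>

text \<open>The parallelogram law makes a minimizing sequence Cauchy, because midpoints stay in
  \<open>L\<close> and cannot come closer to \<open>v\<close> than the infimum; completeness
  supplies the limit.\<close>

lemma nearest_point_exists:
  fixes L :: "'a::chilbert_space set"
  assumes L: "closed L" "convex L" "L \<noteq> {}"
  shows "\<exists>w\<in>L. \<forall>z\<in>L. norm (v - w) \<le> norm (v - z)"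
proof -
  define \<delta> where "\<delta> = infdist v L"
  have le: "\<delta> \<le> norm (v - z)" if "z \<in> L" for z
    unfolding \<delta>_def using infdist_le[OF that, of v] by (simp add: dist_norm)
  have "\<delta> \<ge> 0" unfolding \<delta>_def by (rule infdist_nonneg)
  have bdd: "bdd_below (dist v ` L)"
    by (rule bdd_below.I2[of _ 0]) simp
  \<comment> \<open>The slack is put on the squared distance so that it enters the parallelogram law
    linearly.\<close>
  have "\<exists>w\<in>L. (norm (v - w))\<^sup>2 < \<delta>\<^sup>2 + inverse (Suc n)" for n
  proof -
    have "\<delta> < sqrt (\<delta>\<^sup>2 + inverse (Suc n))"
      by (rule real_less_rsqrt) simp
    then obtain w where "w \<in> L" "norm (v - w) < sqrt (\<delta>\<^sup>2 + inverse (Suc n))"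
      using cINF_less_iff[OF L(3) bdd] infdist_notempty[OF L(3), of v]
      by (auto simp: \<delta>_def dist_norm)
    then show ?thesis
      by (metis norm_ge_zero real_sqrt_less_iff real_sqrt_unique)
  qed
  then obtain w where w: "\<And>n. w n \<in> L"
    and w_lt: "\<And>n. (norm (v - w n))\<^sup>2 < \<delta>\<^sup>2 + inverse (Suc n)"
    by metis
  have gap: "(norm (w m - w n))\<^sup>2 \<le> 2 * inverse (Suc m) + 2 * inverse (Suc n)" for m n
  proof -
    have "(1/2) *\<^sub>R w m + (1/2) *\<^sub>R w n \<in> L"
      using L(2) w by (intro convexD) auto
    from le[OF this] have "\<delta>\<^sup>2 \<le> (norm (v - ((1/2) *\<^sub>R w m + (1/2) *\<^sub>R w n)))\<^sup>2"
      using \<open>\<delta> \<ge> 0\<close> by (simp add: power_mono)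
    \<comment> \<open>The sum is twice the vector from the midpoint to \<open>v\<close>, so its
      squared norm is at least 4 times \<open>\<delta>\<^sup>2\<close>, which cancels the main terms
      of the parallelogram law.\<close>
    moreover have "(v - w m) + (v - w n) = 2 *\<^sub>R (v - ((1/2) *\<^sub>R w m + (1/2) *\<^sub>R w n))"
      by (simp add: algebra_simps scaleR_2)
    then have "(norm ((v - w m) + (v - w n)))\<^sup>2
        = 4 * (norm (v - ((1/2) *\<^sub>R w m + (1/2) *\<^sub>R w n)))\<^sup>2"
      by (simp add: power_mult_distrib)
    ultimately show ?thesis
      using parallelogram_law[of "v - w m" "v - w n"] w_lt[of m] w_lt[of n]
      by (simp add: norm_minus_commute)
  qed
  have "Cauchy w"
  proof (rule metric_CauchyI)
    fix r :: real assume "0 < r"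
    then obtain N where N: "inverse (Suc N) < r\<^sup>2 / 4"
      using reals_Archimedean[of "r\<^sup>2 / 4"] by auto
    show "\<exists>M. \<forall>m\<ge>M. \<forall>n\<ge>M. dist (w m) (w n) < r"
    proof (intro exI allI impI)
      fix m n assume "N \<le> m" "N \<le> n"
      then have "inverse (Suc m) \<le> inverse (real (Suc N))"
        "inverse (Suc n) \<le> inverse (real (Suc N))"
        by simp_all
      with gap[of m n] N have "(norm (w m - w n))\<^sup>2 < r\<^sup>2" by linarith
      then show "dist (w m) (w n) < r"
        using \<open>0 < r\<close> by (simp add: dist_norm power_less_imp_less_base)
    qed
  qed
  then obtain l where l: "w \<longlonglongrightarrow> l"
    using Cauchy_convergent convergent_def by blast
  have "l \<in> L" using closed_sequentially[OF L(1)] w l by blast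
  moreover have "(\<lambda>n. (norm (v - w n))\<^sup>2) \<longlonglongrightarrow> (norm (v - l))\<^sup>2"
    by (intro tendsto_intros l)
  moreover have "(\<lambda>n. \<delta>\<^sup>2 + inverse (real (Suc n))) \<longlonglongrightarrow> \<delta>\<^sup>2"
    using tendsto_add[OF tendsto_const[of "\<delta>\<^sup>2"] LIMSEQ_inverse_real_of_nat] by simp
  ultimately have "(norm (v - l))\<^sup>2 \<le> \<delta>\<^sup>2"
    using w_lt by (intro LIMSEQ_le[of _ _ _ "\<delta>\<^sup>2"]) (auto intro: less_imp_le)
  then have "norm (v - l) \<le> \<delta>"
    using \<open>\<delta> \<ge> 0\<close> by (rule power2_le_imp_le)
  with \<open>l \<in> L\<close> le show ?thesis by (meson order_trans)
qed

lemma csubspace_imp_subspace: "csubspace L \<Longrightarrow> subspace L"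
  by (auto simp: subspace_def scaleR_scaleC complex_vector.subspace_def)

lemma orthogonal_projection_exists:
  fixes L :: "'a::chilbert_space set"
  assumes "closed_csubspace L"
  shows "\<exists>w\<in>L. \<forall>z\<in>L. cinner z (v - w) = 0"
proof -
  have L: "csubspace L" "closed L" using assms by (simp_all add: closed_csubspace_def)
  then obtain w where w: "w \<in> L" and min: "\<And>z. z \<in> L \<Longrightarrow> norm (v - w) \<le> norm (v - z)"
    using nearest_point_exists[of L v] complex_vector.subspace_0
    by (metis csubspace_imp_subspace empty_iff subspace_imp_convex)
  have "cinner z (v - w) = 0" if z: "z \<in> L" for z
  proof (cases "z = 0")
    case False
    \<comment> \<open>The coefficient of the residual along \<open>z\<close>: moving from
      \<open>w\<close> by this multiple of \<open>z\<close> would reduce the distance to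
      \<open>v\<close> unless the inner product vanishes.\<close>
    define c where "c = cinner z (v - w) / (norm z)\<^sup>2"
    have "w + c *\<^sub>C z \<in> L"
      using L(1) w z by (simp add: complex_vector.subspace_add complex_vector.subspace_scale)
    from min[OF this] have "(norm (v - w))\<^sup>2 \<le> (norm (v - w - c *\<^sub>C z))\<^sup>2"
      by (simp add: power_mono diff_diff_eq)
    also have "\<dots> = (norm (v - w))\<^sup>2 - (cmod (cinner z (v - w)))\<^sup>2 / (norm z)\<^sup>2"
      unfolding c_def by (rule norm_diff_component_sq[OF False])
    finally show ?thesis
      using False by (simp add: divide_le_0_iff)
  qed simp
  with w show ?thesis by blast
qed

text \<open>Two candidates differ by a vector of \<open>L\<close> that is orthogonal to itself.
  Working with a mere subspace lets this apply directly to images of subspaces under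
  \<open>W \<alpha>\<close>.\<close>

lemma cproj_eqI:
  assumes "csubspace L" and "w \<in> L" and "\<And>z. z \<in> L \<Longrightarrow> cinner z (v - w) = 0"
  shows "cproj L v = w"
  unfolding cproj_def
proof (rule the_equality)
  fix w' assume w': "w' \<in> L \<and> (\<forall>z\<in>L. cinner z (v - w') = 0)"
  then have "w' - w \<in> L" using assms by (simp add: complex_vector.subspace_diff)
  then have "cinner (w' - w) (v - w) - cinner (w' - w) (v - w') = 0"
    using w' assms(3) by simp
  then show "w' = w" by (simp add: cinner_diff_right[symmetric])
qed (use assms in blast)

lemma
  assumes "closed_csubspace L"
  shows cproj_in: "cproj L v \<in> L"
    and cproj_orthogonal: "z \<in> L \<Longrightarrow> cinner z (v - cproj L v) = 0"
proof -
  obtain w where w: "w \<in> L" "\<forall>z\<in>L. cinner z (v - w) = 0"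
    using orthogonal_projection_exists[OF assms] by blast
  moreover have "cproj L v = w"
    using assms w by (intro cproj_eqI) (auto simp: closed_csubspace_def)
  ultimately show "cproj L v \<in> L" "z \<in> L \<Longrightarrow> cinner z (v - cproj L v) = 0" by auto
qed

section \<open>Linear maps, isometries and their adjoints\<close>

lemma clinearD:
  assumes "clinear f"
  shows "f (x + y) = f x + f y" "f (c *\<^sub>C x) = c *\<^sub>C f x" "f (x - y) = f x - f y"
proof -
  interpret f: Vector_Spaces.linear scaleC scaleC f by fact
  show "f (x + y) = f x + f y" "f (c *\<^sub>C x) = c *\<^sub>C f x" "f (x - y) = f x - f y"
    by (rule f.add f.scale f.diff)+
qed

lemma clinear_image_csubspace:
  assumes "clinear f" and "csubspace L"
  shows "csubspace (f ` L)"
proof (rule complex_vector.subspaceI)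
  show "0 \<in> f ` L"
    using clinearD(2)[OF assms(1), of 0 0] complex_vector.subspace_0[OF assms(2)]
    by (metis complex_vector.scale_zero_left image_eqI)
qed (use assms in \<open>auto simp: clinearD(1,2)[OF assms(1), symmetric] complex_vector.subspace_add
    complex_vector.subspace_scale\<close>)

lemma clinear_imp_linear: "clinear f \<Longrightarrow> linear f"
  by (rule linearI) (simp_all add: clinearD scaleR_scaleC)

text \<open>Polarization: norms determine the real part of the inner product, and the imaginary part
  is the real part after multiplying the first argument by the imaginary unit.\<close>

lemma cinner_cisometry:
  assumes "cisometry f"
  shows "cinner (f x) (f y) = cinner x y"
proof (rule complex_eqI)
  have f: "clinear f" "\<And>v. norm (f v) = norm v" using assms by (auto simp: cisometry_def)
  have Re: "Re (cinner (f x) (f y)) = Re (cinner x y)" for x y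
    using norm_add_sq[of "f x" "f y"] norm_add_sq[of x y] f
    by (simp add: clinearD(1)[OF f(1), symmetric])
  show "Re (cinner (f x) (f y)) = Re (cinner x y)" by (rule Re)
  show "Im (cinner (f x) (f y)) = Im (cinner x y)"
    using Re[of "\<i> *\<^sub>C x" y] f(1) by (simp add: clinearD cinner_scaleC_left)
qed

lemma cisometryI:
  assumes "clinear f" and "\<And>v. cinner (f v) (f v) = cinner v v"
  shows "cisometry f"
  unfolding cisometry_def
proof (intro conjI allI assms(1))
  fix v
  have "complex_of_real ((norm (f v))\<^sup>2) = complex_of_real ((norm v)\<^sup>2)"
    using assms(2)[of v] by (simp only: cinner_self)
  then have "(norm (f v))\<^sup>2 = (norm v)\<^sup>2" using of_real_eq_iff by blast
  then show "norm (f v) = norm v" by simp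
qed

lemma cisometry_comp:
  assumes "cisometry f" "cisometry g"
  shows "cisometry (f \<circ> g)"
  using assms by (auto simp: cisometry_def intro: Vector_Spaces.linear_compose)

text \<open>An isometric image of a complete space is complete. Closedness makes the projection onto
  the range available for constructing the adjoint.\<close>

lemma cisometry_range_closed:
  fixes f :: "'a::chilbert_space \<Rightarrow> 'b::chilbert_space"
  assumes "cisometry f"
  shows "closed (range f)"
proof -
  have f: "linear f" "\<And>v. norm (f v) = norm v"
    using assms by (auto simp: cisometry_def clinear_imp_linear)
  have "bounded_linear f"
    using f by (intro bounded_linear_intro[of _ 1]) (simp_all add: linear_add linear_scale)
  then have "complete (range f)"
    using f by (intro complete_isometric_image[of 1]) (auto simp: complete_UNIV)
  then show ?thesis by (rule complete_imp_closed)
qed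

text \<open>The adjoint of an isometry is the projection onto its range followed by the inverse.\<close>

lemma cinner_cadjoint:
  fixes f :: "'a::chilbert_space \<Rightarrow> 'b::chilbert_space"
  assumes "cisometry f"
  shows "cinner v (cadjoint f w) = cinner (f v) w"
proof -
  have "closed_csubspace (range f)"
    using assms cisometry_range_closed[OF assms]
    by (simp add: closed_csubspace_def cisometry_def clinear_image_csubspace)
  note proj = cproj_in[OF this] cproj_orthogonal[OF this]
  define g where "g w = inv f (cproj (range f) w)" for w
  have fg: "f (g w) = cproj (range f) w" for w
    unfolding g_def using proj(1) by (rule f_inv_into_f)
  have g: "cinner (f v) w = cinner v (g w)" for v w
    using proj(2)[of "f v" w] cinner_cisometry[OF assms, of v "g w"]
    by (simp add: fg cinner_diff_right)
  have "cadjoint f = g"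
    unfolding cadjoint_def
  proof (rule the_equality)
    fix g' assume "\<forall>v w. cinner (f v) w = cinner v (g' w)"
    then have "cinner (g' w - g w) (g' w - g w) = 0" for w
      using g by (simp add: cinner_diff_right)
    then show "g' = g" by (intro ext) simp
  qed (use g in blast)
  then show ?thesis by (simp add: g)
qed

section \<open>Geometry of a process: orthogonality of the shifted innovation spaces\<close>

locale weak_markov_process =
  fixes T :: "'h::chilbert_space \<Rightarrow> 'p::chilbert_space \<Rightarrow> 'hp::chilbert_space"
    and d :: enat and e :: "nat \<Rightarrow> 'p" and V :: "'hp \<Rightarrow> 'h" and h :: "'h set"
  assumes tensor: "hilbert_tensor T"
    and basis: "orthonormal_basis d e"
    and process: "markov_process T d e V h"
begin

abbreviation S :: "nat \<Rightarrow> 'h \<Rightarrow> 'h" where "S \<equiv> row_op T e V"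
abbreviation W :: "nat list \<Rightarrow> 'h \<Rightarrow> 'h" where "W \<equiv> word_op T e V"
abbreviation \<E> :: "'h set" where "\<E> \<equiv> innovation_space T V h"
text \<open>The space reached after one step, which is h \<oplus> \<E>. The closed-span form shows
  directly that it contains every \<open>S k v\<close> with \<open>v \<in> h\<close>.\<close>

abbreviation h\<^sub>1 :: "'h set" where
  "h\<^sub>1 \<equiv> closed_cspan (h \<union> V ` closed_cspan {T v a | v a. v \<in> h})"

lemma V_isometry: "cisometry V"
  and h_closed: "closed_csubspace h"
  and h_csubspace: "csubspace h"
  and h_coinvariant: "k \<in> letters d \<Longrightarrow> v \<in> h \<Longrightarrow> cadjoint (S k) v \<in> h"
  using process by (auto simp: markov_process_def closed_csubspace_def)

lemma cinner_tensor: "cinner (T v a) (T w b) = cinner v w * cinner a b"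
  using tensor by (simp add: hilbert_tensor_def)

lemma cinner_row_op:
  assumes "j \<in> letters d" "k \<in> letters d"
  shows "cinner (S j v) (S k w) = (if j = k then cinner v w else 0)"
  using basis assms
  by (auto simp: row_op_def cinner_cisometry[OF V_isometry] cinner_tensor orthonormal_basis_def)

lemma row_op_isometry:
  assumes "k \<in> letters d"
  shows "cisometry (S k)"
proof (rule cisometryI)
  have "clinear (V \<circ> (\<lambda>v. T v (e k)))"
    using tensor V_isometry
    by (intro Vector_Spaces.linear_compose) (auto simp: hilbert_tensor_def cisometry_def)
  moreover have "S k = V \<circ> (\<lambda>v. T v (e k))" by (auto simp: row_op_def)
  ultimately show "clinear (S k)" by simp
qed (simp add: cinner_row_op assms)

lemma word_op_isometry:
  assumes "\<alpha> \<in> free_words d"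
  shows "cisometry (W \<alpha>)"
  using assms
proof (induction \<alpha>)
  case Nil
  show ?case by (simp add: cisometry_def id_def complex_vector.linear_ident)
next
  case (Cons k \<alpha>)
  then show ?case
    by (auto simp: free_words_def comp_def intro: cisometry_comp[unfolded comp_def] row_op_isometry)
qed

text \<open>The recursion of \<open>word_op\<close> peels off the first letter, whereas the state
  equation adds a last one.\<close>

lemma word_op_append: "W (\<alpha> @ \<beta>) = W \<alpha> \<circ> W \<beta>"
  by (induction \<alpha>) (auto simp: comp_assoc)

lemma h_subset_h1: "h \<subseteq> h\<^sub>1"
  using closed_cspan_superset by blast

lemma row_op_in_h1: "v \<in> h \<Longrightarrow> S k v \<in> h\<^sub>1"
  using closed_cspan_superset[of "{T v a | v a. v \<in> h}"]
    closed_cspan_superset[of "h \<union> V ` closed_cspan {T v a | v a. v \<in> h}"]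
  by (auto simp: row_op_def)

lemma \<E>_subset_h1: "\<E> \<subseteq> h\<^sub>1"
  and \<E>_orthogonal_h: "v \<in> \<E> \<Longrightarrow> z \<in> h \<Longrightarrow> cinner z v = 0"
  by (auto simp: innovation_space_def)

text \<open>Subtracting its projection onto \<open>h\<close> from a vector of
  \<open>h\<^sub>1\<close> leaves a vector of \<E>.\<close>

lemma orthogonal_h1:
  assumes "\<And>z. z \<in> h \<Longrightarrow> cinner z r = 0" and "\<And>z. z \<in> \<E> \<Longrightarrow> cinner z r = 0"
    and "v \<in> h\<^sub>1"
  shows "cinner v r = 0"
proof -
  have p: "cproj h v \<in> h" by (rule cproj_in[OF h_closed])
  then have "v - cproj h v \<in> \<E>"
    using assms(3) by (auto simp: innovation_space_def cproj_orthogonal[OF h_closed]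
        intro: closed_cspan_diff)
  then have "cinner (v - cproj h v) r = 0" by (rule assms(2))
  with assms(1)[OF p] show ?thesis by (simp add: cinner_diff_left)
qed

text \<open>It suffices to test on the generators of \<open>h\<^sub>1\<close>. On \<open>h\<close>,
  co-invariance moves \<open>S k\<close> across as an adjoint that stays in \<open>h\<close>; on the
  image of the tensors over \<open>h\<close>, \<open>V\<close> cancels and the tensor inner product
  contains a factor \<open>cinner f v\<close> with \<open>v \<in> h\<close>.\<close>

lemma row_op_orthogonal_h1:
  assumes k: "k \<in> letters d" and f: "\<And>z. z \<in> h \<Longrightarrow> cinner z f = 0" and "v \<in> h\<^sub>1"
  shows "cinner v (S k f) = 0"
proof -
  have "cinner (S k f) z = 0" if "z \<in> h \<union> V ` closed_cspan {T v a | v a. v \<in> h}" for z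
    using that
  proof
    assume "z \<in> h"
    then have "cinner (cadjoint (S k) z) f = 0" using f h_coinvariant[OF k] by blast
    then show ?thesis
      by (metis cinner_cadjoint[OF row_op_isometry[OF k]] cinner_orthogonal_commute)
  next
    assume "z \<in> V ` closed_cspan {T v a | v a. v \<in> h}"
    then obtain t where z: "z = V t" and t: "t \<in> closed_cspan {T v a | v a. v \<in> h}" by blast
    have "cinner (T f (e k)) t = 0"
      by (rule orthogonal_closed_cspan[OF _ t])
        (auto simp: cinner_tensor cinner_orthogonal_commute[of f] f)
    then show ?thesis by (simp add: z row_op_def cinner_cisometry[OF V_isometry])
  qed
  then have "cinner (S k f) v = 0" using assms(3) by (rule orthogonal_closed_cspan)
  then show ?thesis by (simp add: cinner_orthogonal_commute)
qed

text \<open>Since \<open>h \<subseteq> h\<^sub>1\<close>, each further letter preserves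
  orthogonality to \<open>h\<close>.\<close>

lemma word_op_orthogonal_h:
  assumes "\<alpha> \<in> free_words d" and "\<And>z. z \<in> h \<Longrightarrow> cinner z f = 0" and "z \<in> h"
  shows "cinner z (W \<alpha> f) = 0"
  using assms(1,3)
proof (induction \<alpha> arbitrary: z)
  case Nil
  then show ?case using assms(2) by simp
next
  case (Cons k \<alpha>)
  then show ?case
    using h_subset_h1 by (auto simp: free_words_def intro!: row_op_orthogonal_h1)
qed

text \<open>Equal first letters cancel and different ones have orthogonal ranges, which leaves the
  case where one word is exhausted.\<close>

lemma word_op_\<E>_orthogonal:
  assumes "\<alpha> \<in> free_words d" "\<beta> \<in> free_words d" "\<alpha> \<noteq> \<beta>" "v \<in> \<E>" "w \<in> \<E>"
  shows "cinner (W \<alpha> v) (W \<beta> w) = 0"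
proof -
  \<comment> \<open>The exhausted case: \<open>W \<gamma> w\<close> is orthogonal to
    \<open>h\<close>, so one more letter makes it orthogonal to \<open>h\<^sub>1\<close>, which
    contains \<E>.\<close>
  have cons: "cinner v (W (k # \<gamma>) w) = 0"
    if "k # \<gamma> \<in> free_words d" "v \<in> \<E>" "w \<in> \<E>" for k \<gamma> v w
  proof -
    have k: "k \<in> letters d" and \<gamma>: "\<gamma> \<in> free_words d"
      using that(1) by (auto simp: free_words_def)
    have "cinner z (W \<gamma> w) = 0" if "z \<in> h" for z
      using \<gamma> \<E>_orthogonal_h[OF \<open>w \<in> \<E>\<close>] that by (rule word_op_orthogonal_h)
    from row_op_orthogonal_h1[OF k this] show ?thesis
      using that(2) \<E>_subset_h1 by auto
  qed
  show ?thesis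
    using assms(1-3)
  proof (induction \<alpha> arbitrary: \<beta>)
    case Nil
    then obtain k \<gamma> where "\<beta> = k # \<gamma>" by (cases \<beta>) auto
    with Nil assms cons show ?case by simp
  next
    case (Cons j \<alpha>)
    show ?case
    proof (cases \<beta>)
      case Nil
      then show ?thesis
        using cons[of j \<alpha> w v] Cons.prems assms by (simp add: cinner_orthogonal_commute)
    next
      case \<beta>: (Cons k \<gamma>)
      with Cons show ?thesis by (auto simp: cinner_row_op free_words_def)
    qed
  qed
qed

text \<open>This places the values of the input maps \<open>B k\<close> in \<open>h\<close>. The
  part \<open>f\<close> of the adjoint image orthogonal to \<open>h\<close> satisfies
  \<open>cinner v (S k f) = 0\<close>, hence is orthogonal to the adjoint image and so to
  itself.\<close>

lemma cadjoint_row_op_\<E>: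
  assumes k: "k \<in> letters d" and v: "v \<in> \<E>"
  shows "cadjoint (S k) v \<in> h"
proof -
  define f where "f = cadjoint (S k) v - cproj h (cadjoint (S k) v)"
  have f: "cinner z f = 0" if "z \<in> h" for z
    unfolding f_def using that by (rule cproj_orthogonal[OF h_closed])
  have "cinner v (S k f) = 0"
    using v \<E>_subset_h1 by (intro row_op_orthogonal_h1[OF k f]) auto
  then have "cinner f (cadjoint (S k) v) = 0"
    by (simp add: cinner_cadjoint[OF row_op_isometry[OF k]] cinner_orthogonal_commute)
  moreover have "cinner f (cproj h (cadjoint (S k) v)) = 0"
    using f[OF cproj_in[OF h_closed]] by (simp add: cinner_orthogonal_commute)
  ultimately have "cinner f f = 0"
    by (subst (2) f_def) (simp add: cinner_diff_right)
  then show ?thesis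
    using cproj_in[OF h_closed, of "cadjoint (S k) v"] by (simp add: f_def)
qed

section \<open>Coefficients of the trajectory vector\<close>

text \<open>Pairing with a fixed vector is continuous and passes through the series; by
  orthogonality no term survives against \<open>h\<close>, and only the matching word survives
  against a shifted \<E>.\<close>

lemma
  assumes \<xi>: "\<xi> \<in> h"
    and \<eta>: "\<And>\<alpha>. \<alpha> \<in> free_words d \<Longrightarrow> \<eta> \<alpha> \<in> \<E>"
    and sum: "((\<lambda>\<alpha>. W \<alpha> (\<eta> \<alpha>)) has_sum (\<xi>t - \<xi>)) (free_words d)"
  shows cinner_h_trajectory: "z \<in> h \<Longrightarrow> cinner z \<xi>t = cinner z \<xi>"
    and cinner_word_\<E>_trajectory:
      "\<alpha> \<in> free_words d \<Longrightarrow> z \<in> \<E> \<Longrightarrow> cinner (W \<alpha> z) \<xi>t = cinner z (\<eta> \<alpha>)"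
proof -
  have sum': "((\<lambda>\<beta>. cinner w (W \<beta> (\<eta> \<beta>))) has_sum (cinner w \<xi>t - cinner w \<xi>)) (free_words d)" for w
    using has_sum_bounded_linear[OF bounded_linear_cinner sum, of w]
    by (simp add: cinner_diff_right)
  show "cinner z \<xi>t = cinner z \<xi>" if z: "z \<in> h"
  proof -
    have "cinner z (W \<beta> (\<eta> \<beta>)) = 0" if "\<beta> \<in> free_words d" for \<beta>
      using that \<E>_orthogonal_h[OF \<eta>[OF that]] z by (rule word_op_orthogonal_h)
    then have "((\<lambda>\<beta>. cinner z (W \<beta> (\<eta> \<beta>))) has_sum 0) (free_words d)"
      by (rule has_sum_0)
    from has_sum_unique[OF sum' this] show ?thesis by simp
  qed
  show "cinner (W \<alpha> z) \<xi>t = cinner z (\<eta> \<alpha>)" if \<alpha>: "\<alpha> \<in> free_words d" and z: "z \<in> \<E>"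
  proof -
    have "((\<lambda>\<beta>. cinner (W \<alpha> z) (W \<beta> (\<eta> \<beta>))) has_sum cinner z (\<eta> \<alpha>)) (free_words d)"
      using \<alpha> z \<eta>
      by (intro has_sum_finite_neutralI[of "{\<alpha>}"])
        (auto simp: cinner_cisometry[OF word_op_isometry] intro!: word_op_\<E>_orthogonal)
    from has_sum_unique[OF sum' this] have "cinner (W \<alpha> z) \<xi>t - cinner (W \<alpha> z) \<xi> = cinner z (\<eta> \<alpha>)" .
    \<comment> \<open>The series represents \<open>\<xi>t - \<xi>\<close>, so the contribution of
      the initial state must be removed separately.\<close>
    moreover have "cinner (W \<alpha> z) \<xi> = 0"
      using word_op_orthogonal_h[OF \<alpha> \<E>_orthogonal_h[OF z] \<xi>] cinner_orthogonal_commute by blast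
    ultimately show ?thesis by simp
  qed
qed

text \<open>The residual, after removing the projection onto \<open>h\<close> and
  \<open>\<eta> \<alpha>\<close>, is orthogonal to both \<open>h\<close> and \<E>, hence to
  \<open>h\<^sub>1\<close>. This weak form suffices because projections are identified by
  testing.\<close>

lemma cinner_word_trajectory:
  assumes "\<xi> \<in> h" "\<And>\<alpha>. \<alpha> \<in> free_words d \<Longrightarrow> \<eta> \<alpha> \<in> \<E>"
    and "((\<lambda>\<alpha>. W \<alpha> (\<eta> \<alpha>)) has_sum (\<xi>t - \<xi>)) (free_words d)"
    and \<alpha>: "\<alpha> \<in> free_words d" and "v \<in> h\<^sub>1"
  shows "cinner (W \<alpha> v) \<xi>t = cinner v (cproj h (cadjoint (W \<alpha>) \<xi>t) + \<eta> \<alpha>)"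
proof -
  define w where "w = cadjoint (W \<alpha>) \<xi>t"
  have w: "cinner z w = cinner (W \<alpha> z) \<xi>t" for z
    unfolding w_def using cinner_cadjoint[OF word_op_isometry[OF \<alpha>]] .
  have "cinner v (w - cproj h w - \<eta> \<alpha>) = 0"
  proof (rule orthogonal_h1[OF _ _ assms(5)])
    fix z assume "z \<in> h"
    then show "cinner z (w - cproj h w - \<eta> \<alpha>) = 0"
      using cproj_orthogonal[OF h_closed, of z w] \<E>_orthogonal_h[OF assms(2)[OF \<alpha>]]
      by (simp add: cinner_diff_right)
  next
    fix z assume z: "z \<in> \<E>"
    have "cinner z (cproj h w) = 0"
      using \<E>_orthogonal_h[OF z cproj_in[OF h_closed]] by (simp add: cinner_orthogonal_commute)
    moreover have "cinner z w = cinner z (\<eta> \<alpha>)"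
      unfolding w by (rule cinner_word_\<E>_trajectory[OF assms(1-4) z])
    ultimately show "cinner z (w - cproj h w - \<eta> \<alpha>) = 0"
      by (simp add: cinner_diff_right)
  qed
  then show ?thesis
    by (simp add: w[symmetric] w_def[symmetric] cinner_diff_right cinner_add_right diff_eq_eq
        add.commute)
qed

end

section \<open>The state and output equations\<close>

theorem proposition3p2:
  fixes T :: "'h::chilbert_space \<Rightarrow> 'p::chilbert_space \<Rightarrow> 'hp::chilbert_space"
    and d :: enat
    and e :: "nat \<Rightarrow> 'p"
    and V :: "'hp \<Rightarrow> 'h"
    and h U0 Y0 :: "'h set"
    and A B :: "nat \<Rightarrow> 'h \<Rightarrow> 'h"
    and C D :: "'h \<Rightarrow> 'h"
    and \<xi> \<xi>t :: 'h
    and \<eta> x u y :: "nat list \<Rightarrow> 'h"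
  assumes separable: "separable_space (euclidean :: 'h topology)"
    and tensor: "hilbert_tensor T"
    and basis: "orthonormal_basis d e"
    and process: "markov_process T d e V h"
    and structure_maps: "represents T d e V h U0 Y0 A B C D"
    and \<xi>: "\<xi> \<in> h"
    and \<eta>: "\<And>\<alpha>. \<alpha> \<in> free_words d \<Longrightarrow> \<eta> \<alpha> \<in> U0"
    and \<xi>t: "((\<lambda>\<alpha>. word_op T e V \<alpha> (\<eta> \<alpha>)) has_sum (\<xi>t - \<xi>)) (free_words d)"
    and x: "\<And>\<alpha>. \<alpha> \<in> free_words d \<Longrightarrow>
      x \<alpha> = (if \<alpha> = [] then \<xi> else cproj h (cadjoint (word_op T e V \<alpha>) \<xi>t))"
    and u: "\<And>\<alpha>. \<alpha> \<in> free_words d \<Longrightarrow> u \<alpha> = \<eta> \<alpha>"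
    and y: "\<And>\<alpha>. \<alpha> \<in> free_words d \<Longrightarrow> y \<alpha> = cproj Y0 (cadjoint (word_op T e V \<alpha>) \<xi>t)"
  shows "(\<forall>\<alpha>\<in>free_words d.
        word_op T e V \<alpha> (x \<alpha>) = cproj (word_op T e V \<alpha> ` h) \<xi>t \<and>
        word_op T e V \<alpha> (u \<alpha>) = cproj (word_op T e V \<alpha> ` U0) \<xi>t) \<and>
    (\<forall>\<alpha>\<in>free_words d. \<forall>k\<in>letters d. x (\<alpha> @ [k]) = A k (x \<alpha>) + B k (u \<alpha>)) \<and>
    (\<forall>\<alpha>\<in>free_words d. word_op T e V \<alpha> (y \<alpha>) = cproj (word_op T e V \<alpha> ` Y0) \<xi>t) \<and>
    (\<forall>\<alpha>\<in>free_words d. y \<alpha> = C (x \<alpha>) + D (u \<alpha>))"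
proof -
  interpret weak_markov_process T d e V h
    using tensor basis process by unfold_locales
  have U0: "csubspace U0" "U0 \<subseteq> \<E>"
    and Y0: "closed_csubspace Y0" "Y0 \<subseteq> {v + w | v w. v \<in> h \<and> w \<in> \<E>}"
    and A: "\<And>k v. k \<in> letters d \<Longrightarrow> v \<in> h \<Longrightarrow> A k v = cadjoint (S k) v"
    and B: "\<And>k w. k \<in> letters d \<Longrightarrow> w \<in> U0 \<Longrightarrow> B k w = cadjoint (S k) w"
    and C: "\<And>v. v \<in> h \<Longrightarrow> C v = cproj Y0 v"
    and D: "\<And>w. w \<in> U0 \<Longrightarrow> D w = cproj Y0 w"
    using structure_maps by (auto simp: represents_def closed_csubspace_def)
  have Y0_csubspace: "csubspace Y0" using Y0(1) by (simp add: closed_csubspace_def)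
  have \<eta>_\<E>: "\<eta> \<alpha> \<in> \<E>" if "\<alpha> \<in> free_words d" for \<alpha>
    using \<eta>[OF that] U0(2) by blast
  \<comment> \<open>The separate value at the empty word agrees with the general formula, since the
    series is orthogonal to \<open>h\<close>; afterwards all words are treated alike.\<close>
  have x_proj: "x \<alpha> = cproj h (cadjoint (W \<alpha>) \<xi>t)" if \<alpha>: "\<alpha> \<in> free_words d" for \<alpha>
  proof (cases "\<alpha> = []")
    case True
    have "cproj h (cadjoint (W []) \<xi>t) = \<xi>"
      using cinner_h_trajectory[OF \<xi> \<eta>_\<E> \<xi>t] cinner_cadjoint[OF word_op_isometry, of "[]"]
      by (intro cproj_eqI[OF h_csubspace \<xi>]) (simp add: cinner_diff_right free_words_def)
    with x[OF \<alpha>] True show ?thesis by simp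
  qed (simp add: x[OF \<alpha>])
  have x_h: "x \<alpha> \<in> h" if "\<alpha> \<in> free_words d" for \<alpha>
    unfolding x_proj[OF that] by (rule cproj_in[OF h_closed])
  have traj: "cinner (W \<alpha> v) \<xi>t = cinner v (x \<alpha> + \<eta> \<alpha>)" if "\<alpha> \<in> free_words d" "v \<in> h\<^sub>1" for \<alpha> v
    unfolding x_proj[OF that(1)]
    using \<xi> \<eta>_\<E> \<xi>t that by (rule cinner_word_trajectory)
  have Y0_traj: "cinner (W \<alpha> z) \<xi>t = cinner z (x \<alpha> + \<eta> \<alpha>)"
    if \<alpha>: "\<alpha> \<in> free_words d" and z_Y0: "z \<in> Y0" for \<alpha> z
  proof -
    obtain v w where z: "z = v + w" and "v \<in> h" "w \<in> \<E>" using Y0(2) z_Y0 by blast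
    then have "v \<in> h\<^sub>1" "w \<in> h\<^sub>1" using h_subset_h1 \<E>_subset_h1 by auto
    then show ?thesis
      using traj[OF \<alpha>] word_op_isometry[OF \<alpha>]
      by (simp add: z cisometry_def clinearD cinner_add_left)
  qed
  \<comment> \<open>Because \<open>W \<alpha>\<close> is isometric, orthogonality of the residual
    can be tested before applying it. All three projection formulas reduce to this.\<close>
  have word_proj: "W \<alpha> w = cproj (W \<alpha> ` L) \<xi>t"
    if "\<alpha> \<in> free_words d" "csubspace L" "w \<in> L" "\<And>z. z \<in> L \<Longrightarrow> cinner (W \<alpha> z) \<xi>t = cinner z w"
    for \<alpha> w L
    using that word_op_isometry[OF that(1)]
    by (intro cproj_eqI[symmetric])
      (auto simp: cinner_diff_right cinner_cisometry cisometry_def intro: clinear_image_csubspace)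
  have state_proj: "W \<alpha> (x \<alpha>) = cproj (W \<alpha> ` h) \<xi>t" if \<alpha>: "\<alpha> \<in> free_words d" for \<alpha>
  proof (rule word_proj[OF \<alpha> h_csubspace x_h[OF \<alpha>]])
    fix z assume "z \<in> h"
    then show "cinner (W \<alpha> z) \<xi>t = cinner z (x \<alpha>)"
      using traj[OF \<alpha>] h_subset_h1 \<E>_orthogonal_h[OF \<eta>_\<E>[OF \<alpha>]]
      by (auto simp: cinner_add_right)
  qed
  have input_proj: "W \<alpha> (u \<alpha>) = cproj (W \<alpha> ` U0) \<xi>t" if \<alpha>: "\<alpha> \<in> free_words d" for \<alpha>
    unfolding u[OF \<alpha>]
  proof (rule word_proj[OF \<alpha> U0(1) \<eta>[OF \<alpha>]])
    fix z assume "z \<in> U0"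
    then show "cinner (W \<alpha> z) \<xi>t = cinner z (\<eta> \<alpha>)"
      using cinner_word_\<E>_trajectory[OF \<xi> \<eta>_\<E> \<xi>t \<alpha>] U0(2) by blast
  qed
  have evolution: "x (\<alpha> @ [k]) = A k (x \<alpha>) + B k (u \<alpha>)"
    if \<alpha>: "\<alpha> \<in> free_words d" and k: "k \<in> letters d" for \<alpha> k
  proof -
    have \<alpha>k: "\<alpha> @ [k] \<in> free_words d" using \<alpha> k by (simp add: free_words_def)
    \<comment> \<open>For \<open>z \<in> h\<close>, testing the next state against \<open>z\<close>
      tests the current one against \<open>S k z\<close>, which lies in \<open>h\<^sub>1\<close>,
      where \<open>traj\<close> applies.\<close>
    have adjoint_append:
      "cinner z (cadjoint (W (\<alpha> @ [k])) \<xi>t) = cinner (W \<alpha> (S k z)) \<xi>t" for z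
      using cinner_cadjoint[OF word_op_isometry[OF \<alpha>k]] by (simp add: word_op_append)
    have AB: "A k (x \<alpha>) + B k (u \<alpha>) = cadjoint (S k) (x \<alpha>) + cadjoint (S k) (\<eta> \<alpha>)"
      using A[OF k x_h[OF \<alpha>]] B[OF k \<eta>[OF \<alpha>]] u[OF \<alpha>] by simp
    show ?thesis
      unfolding x_proj[OF \<alpha>k] AB
    proof (rule cproj_eqI[OF h_csubspace])
      show "cadjoint (S k) (x \<alpha>) + cadjoint (S k) (\<eta> \<alpha>) \<in> h"
        using h_csubspace h_coinvariant[OF k x_h[OF \<alpha>]] cadjoint_row_op_\<E>[OF k \<eta>_\<E>[OF \<alpha>]]
        by (rule complex_vector.subspace_add)
      fix z assume "z \<in> h"
      then show "cinner z (cadjoint (W (\<alpha> @ [k])) \<xi>t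
          - (cadjoint (S k) (x \<alpha>) + cadjoint (S k) (\<eta> \<alpha>))) = 0"
        using traj[OF \<alpha> row_op_in_h1[of z k]]
        by (simp add: cinner_diff_right cinner_add_right adjoint_append
            cinner_cadjoint[OF row_op_isometry[OF k]])
    qed
  qed
  have output_eq: "y \<alpha> = C (x \<alpha>) + D (u \<alpha>)" if \<alpha>: "\<alpha> \<in> free_words d" for \<alpha>
  proof -
    have CD: "C (x \<alpha>) + D (u \<alpha>) = cproj Y0 (x \<alpha>) + cproj Y0 (\<eta> \<alpha>)"
      using C[OF x_h[OF \<alpha>]] D[OF \<eta>[OF \<alpha>]] u[OF \<alpha>] by simp
    show ?thesis
      unfolding y[OF \<alpha>] CD
    \<comment> \<open>The sum of the two projections is the candidate; by \<open>Y0_traj\<close>,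
      vectors of \<open>Y0\<close> cannot distinguish the pulled-back trajectory from
      \<open>x \<alpha> + \<eta> \<alpha>\<close>.\<close>
    proof (rule cproj_eqI[OF Y0_csubspace])
      show "cproj Y0 (x \<alpha>) + cproj Y0 (\<eta> \<alpha>) \<in> Y0"
        using Y0_csubspace cproj_in[OF Y0(1)] cproj_in[OF Y0(1)] by (rule complex_vector.subspace_add)
      fix z assume "z \<in> Y0"
      then show "cinner z (cadjoint (W \<alpha>) \<xi>t - (cproj Y0 (x \<alpha>) + cproj Y0 (\<eta> \<alpha>))) = 0"
        using Y0_traj[OF \<alpha>] cproj_orthogonal[OF Y0(1), of z "x \<alpha>"]
          cproj_orthogonal[OF Y0(1), of z "\<eta> \<alpha>"]
        by (simp add: cinner_diff_right cinner_add_right cinner_cadjoint[OF word_op_isometry[OF \<alpha>]])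
    qed
  qed
  have output_proj: "W \<alpha> (y \<alpha>) = cproj (W \<alpha> ` Y0) \<xi>t" if \<alpha>: "\<alpha> \<in> free_words d" for \<alpha>
    unfolding y[OF \<alpha>]
  proof (rule word_proj[OF \<alpha> Y0_csubspace cproj_in[OF Y0(1)]])
    fix z assume "z \<in> Y0"
    then show "cinner (W \<alpha> z) \<xi>t = cinner z (cproj Y0 (cadjoint (W \<alpha>) \<xi>t))"
      using cproj_orthogonal[OF Y0(1), of z "cadjoint (W \<alpha>) \<xi>t"]
      by (simp add: cinner_diff_right cinner_cadjoint[OF word_op_isometry[OF \<alpha>]])
  qed
  show ?thesis
    using state_proj input_proj evolution output_proj output_eq by blast
qed

end
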